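(* Let $\theta$ be an action of an inverse semigroup $S$ on a locally compact Hausdorff space $X$. For $x\in X$, define $\tau_x\in\prod_{e\in E(S)}\widetilde{X_e}$ by $\tau_x(e)=x$ if $x\in X_e$, and $\tau_x(e)=\infty_e$ otherwise. Then $\tau_x\in X^{\mathrm{KS}}$, and the map $\iota_X\colon X\ni x\mapsto\tau_x\in X^{\mathrm{KS}}$ is continuous.
   Context: An inverse semigroup is a semigroup $S$ in which every $s$ has a unique $s^*$ with $ss^*s=s$, $s^*ss^*=s^*$; $E(S)$ is its commutative subsemigroup of idempotents; $s\le t$ means $ts^*s=s$. An action $\theta$ of $S$ on a topological space $X$ is a semigroup homomorphism $s\mapsto\theta_s$ from $S$ to the inverse semigroup of partial bijections of $X$ (bijections between subsets, composed on the largest possible domain) such that, writing $X_e$ for the subset on which $\theta_e$ ($e\in E(S)$) is the identity (so $\theta_s$ is a bijection $X_{s^*s}\to X_{ss^*}$): each $X_e$ is open, each $\theta_s\colon X_{s^*s}\to X_{ss^*}$ is continuous, and $\bigcup_{e\in E(S)}X_e=X$. For each $e\in E(S)$ let $\widetilde{X_e}=X_e\sqcup\{\infty_e\}$ be the one-point compactification of $X_e$ (a point $\infty_e$ is added even when $X_e$ is compact). $\widetilde{X^{\mathrm{KS}}}$ is the set of $\tau\in\prod_{e\in E(S)}\widetilde{X_e}$ such that (1) if $e_1\le e_2$ and $\tau(e_1)\ne\infty_{e_1}$, then $\tau(e_2)=\tau(e_1)$ (as points of $X$); (2) if $\tau(e_1)\neq\infty_{e_1}$ and $\tau(e_2)\neq\infty_{e_2}$,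 then $\tau(e_1e_2)\neq\infty_{e_1e_2}$; it carries the topology induced from the product topology. $X^{\mathrm{KS}}=\widetilde{X^{\mathrm{KS}}}\setminus\{\infty\}$, where $\infty=(\infty_e)_{e\in E(S)}$. *)

theory Defs
  imports "HOL-Analysis.Analysis"
begin

class inverse_semigroup = semigroup_mult +
  assumes ex1_star: "\<exists>!t. s * t * s = s \<and> t * s * t = t"
begin

definition star :: "'a \<Rightarrow> 'a"
  where "star s = (THE t. s * t * s = s \<and> t * s * t = t)"

lemma star: "s * star s * s = s" "star s * s * star s = star s"
  using theI'[OF ex1_star[of s]] by (simp_all add: star_def)

lemma star_unique: "s * t * s = s \<Longrightarrow> t * s * t = t \<Longrightarrow> star s = t"
  using ex1_star[of s] star[of s] by blast

definition idempotents :: "'a set"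
  where "idempotents = {e. e * e = e}"

definition natural_le :: "'a \<Rightarrow> 'a \<Rightarrow> bool"
  where "natural_le s t \<longleftrightarrow> t * star s * s = s"

lemma star_mult_self_idempotent: "star s * s \<in> idempotents"
  using star[of s] by (simp add: idempotents_def flip: mult.assoc)

lemma mult_star_self_idempotent: "s * star s \<in> idempotents"
  using star[of s] by (simp add: idempotents_def flip: mult.assoc)

lemma star_idempotent: "e \<in> idempotents \<Longrightarrow> star e = e"
  by (rule star_unique) (simp_all add: idempotents_def)

lemma idempotents_mult_closed:
  assumes "e \<in> idempotents" "f \<in> idempotents"
  shows "e * f \<in> idempotents"
proof -
  have e: "e * e = e" and f: "f * f = f"
    using assms by (simp_all add: idempotents_def)
  have e': "e * (e * z) = e * z" and f': "f * (f * z) = f * z" for z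
    using e f by (simp_all flip: mult.assoc)
  define x where "x = star (e * f)"
  have x1: "e * (f * (x * (e * f))) = e * f" and x2: "x * (e * (f * x)) = x"
    using star[of "e * f"] by (simp_all add: x_def mult.assoc)
  have x2': "x * (e * (f * (x * z))) = x * z" for z
    using arg_cong[OF x2, of "\<lambda>u. u * z"] by (simp add: mult.assoc)
  have "x = f * x * e"
    using star_unique[of "e * f" "f * x * e"]
    by (simp add: x_def[symmetric] mult.assoc e' f' x1 x2')
  then have "x * x = x"
    using x2' by (metis mult.assoc)
  then have "x \<in> idempotents"
    by (simp add: idempotents_def)
  moreover have "star x = e * f"
    using star_unique[of x "e * f"] x1 x2 by (simp add: mult.assoc)
  ultimately show ?thesis
    using star_idempotent by metis
qed

end

text \<open>
  Partial maps on the carrier of \<open>X\<close> are functions into the option type, undefined points being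
  sent to \<^term>\<open>None\<close>; \<open>\<circ>\<^sub>m\<close> is composition on the largest possible domain.
\<close>

definition partial_bijection_on :: "'x set \<Rightarrow> ('x \<rightharpoonup> 'x) \<Rightarrow> bool"
  where "partial_bijection_on A f \<longleftrightarrow> dom f \<subseteq> A \<and> ran f \<subseteq> A \<and> inj_on f (dom f)"

definition id_dom :: "('s \<Rightarrow> 'x \<rightharpoonup> 'x) \<Rightarrow> 's \<Rightarrow> 'x set"
  where "id_dom \<theta> e = {x. \<theta> e x = Some x}"

locale inverse_semigroup_action =
  fixes X :: "'x topology"
    and \<theta> :: "'s::inverse_semigroup \<Rightarrow> 'x \<rightharpoonup> 'x"
  assumes partial_bij: "partial_bijection_on (topspace X) (\<theta> s)"
    and hom: "\<theta> (s * t) = \<theta> s \<circ>\<^sub>m \<theta> t"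
    and open_dom: "e \<in> idempotents \<Longrightarrow> openin X (id_dom \<theta> e)"
    and cont: "continuous_map (subtopology X (id_dom \<theta> (star s * s)))
                 (subtopology X (id_dom \<theta> (s * star s))) (the \<circ> \<theta> s)"
    and cover: "(\<Union>e\<in>idempotents. id_dom \<theta> e) = topspace X"
begin

lemma dom_idempotent:
  assumes "e \<in> idempotents"
  shows "dom (\<theta> e) = id_dom \<theta> e"
proof -
  have "\<theta> e x = Some x" if "\<theta> e x = Some y" for x y
  proof -
    have "(\<theta> e \<circ>\<^sub>m \<theta> e) x = \<theta> e x"
      using hom[of e e] assms by (simp add: idempotents_def)
    then have "\<theta> e y = Some y"
      using that by simp
    then have "x = y"
      using partial_bij[of e] that by (auto simp: partial_bijection_on_def inj_on_def dom_def)
    then show ?thesis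
      using that by simp
  qed
  then show ?thesis
    by (auto simp: id_dom_def)
qed

lemma dom_action: "dom (\<theta> s) = id_dom \<theta> (star s * s)"
proof -
  have "\<theta> s = \<theta> s \<circ>\<^sub>m \<theta> (star s * s)"
    using hom[of s "star s * s"] star(1)[of s] by (simp add: mult.assoc)
  then have "dom (\<theta> s) \<subseteq> dom (\<theta> (star s * s))"
    by (metis (no_types, lifting) domIff map_comp_simps(1) subsetI)
  moreover have "dom (\<theta> (star s * s)) \<subseteq> dom (\<theta> s)"
    using hom[of "star s" s] by (auto simp: map_comp_def split: option.splits)
  ultimately show ?thesis
    using dom_idempotent[OF star_mult_self_idempotent] by blast
qed

end

text \<open>
  \<^const>\<open>Alexandroff_compactification\<close> always adds the point \<^term>\<open>None\<close>, also to a compact space;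
  its other points have the form \<^term>\<open>Some x\<close>, so equality of values at different indices is
  equality as points of \<open>X\<close>.
\<close>

definition KS_product :: "'x topology \<Rightarrow> ('s::inverse_semigroup \<Rightarrow> 'x \<rightharpoonup> 'x) \<Rightarrow> ('s \<Rightarrow> 'x option) topology"
  where "KS_product X \<theta> =
    product_topology (\<lambda>e. Alexandroff_compactification (subtopology X (id_dom \<theta> e))) idempotents"

definition KS_tilde_set :: "'x topology \<Rightarrow> ('s::inverse_semigroup \<Rightarrow> 'x \<rightharpoonup> 'x) \<Rightarrow> ('s \<Rightarrow> 'x option) set"
  where "KS_tilde_set X \<theta> = {\<tau> \<in> topspace (KS_product X \<theta>).
    (\<forall>e1\<in>idempotents. \<forall>e2\<in>idempotents. natural_le e1 e2 \<and> \<tau> e1 \<noteq> None \<longrightarrow> \<tau> e2 = \<tau> e1) \<and>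
    (\<forall>e1\<in>idempotents. \<forall>e2\<in>idempotents. \<tau> e1 \<noteq> None \<and> \<tau> e2 \<noteq> None \<longrightarrow> \<tau> (e1 * e2) \<noteq> None)}"

definition KS_tilde :: "'x topology \<Rightarrow> ('s::inverse_semigroup \<Rightarrow> 'x \<rightharpoonup> 'x) \<Rightarrow> ('s \<Rightarrow> 'x option) topology"
  where "KS_tilde X \<theta> = subtopology (KS_product X \<theta>) (KS_tilde_set X \<theta>)"

definition KS_infinity :: "'s::inverse_semigroup \<Rightarrow> 'x option"
  where "KS_infinity = (\<lambda>e\<in>idempotents. None)"

definition KS :: "'x topology \<Rightarrow> ('s::inverse_semigroup \<Rightarrow> 'x \<rightharpoonup> 'x) \<Rightarrow> ('s \<Rightarrow> 'x option) topology"
  where "KS X \<theta> = subtopology (KS_tilde X \<theta>) (KS_tilde_set X \<theta> - {KS_infinity})"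

definition KS_point :: "('s::inverse_semigroup \<Rightarrow> 'x \<rightharpoonup> 'x) \<Rightarrow> 'x \<Rightarrow> 's \<Rightarrow> 'x option"
  where "KS_point \<theta> x = (\<lambda>e\<in>idempotents. if x \<in> id_dom \<theta> e then Some x else None)"

end

theory Submission
  imports Defs
begin

text \<open>
  Membership of \<open>\<tau>\<^sub>x\<close> in the spectrum is a translation of the homomorphism property of the action:
  for idempotents, \<open>X\<^bsub>ef\<^esub> = X\<^bsub>e\<^esub> \<inter> X\<^bsub>f\<^esub>\<close>, so the set of \<open>e\<close> with \<open>x \<in> X\<^bsub>e\<^esub>\<close> is closed upwards
  and under products, and it is nonempty because the sets \<open>X\<^bsub>e\<^esub>\<close> cover \<open>X\<close>.

  Continuity into a product is checked one coordinate at a time. The coordinate at \<open>e\<close> is the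
  map from \<open>X\<close> into the one-point compactification of the open set \<open>X\<^bsub>e\<^esub>\<close> that collapses the
  complement of \<open>X\<^bsub>e\<^esub>\<close> to the point at infinity. It is continuous because \<open>X\<close> is Hausdorff: an
  open neighbourhood of infinity omits only a compact subset of \<open>X\<^bsub>e\<^esub>\<close>, and such a set is closed
  in all of \<open>X\<close> and not merely in \<open>X\<^bsub>e\<^esub>\<close> (lemma \<open>continuous_map_collapse_complement\<close>).
\<close>

text \<open>
  Openness of \<open>U\<close> serves the neighbourhoods of the finite points, the Hausdorff property those of
  the point at infinity.
\<close>

lemma continuous_map_collapse_complement:
  assumes "Hausdorff_space X" and "openin X U"
  shows "continuous_map X (Alexandroff_compactification (subtopology X U))
           (\<lambda>x. if x \<in> U then Some x else None)"
    (is "continuous_map X _ ?c")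
proof (unfold continuous_map, intro conjI allI impI)
  have "U \<subseteq> topspace X"
    using assms(2) by (rule openin_subset)
  then show "?c ` topspace X \<subseteq> topspace (Alexandroff_compactification (subtopology X U))"
    by auto
  fix W
  assume "openin (Alexandroff_compactification (subtopology X U)) W"
  then consider (finite_part) V where "openin (subtopology X U) V" "W = Some ` V"
    | (infinity) C where "compactin (subtopology X U) C"
        "W = insert None (Some ` (topspace (subtopology X U) - C))"
    unfolding openin_Alexandroff_compactification by blast
  then show "openin X {x \<in> topspace X. ?c x \<in> W}"
  proof cases
    case finite_part
    then have "openin X V" and "V \<subseteq> U"
      using assms(2) by (simp_all add: openin_open_subtopology)
    moreover have "{x \<in> topspace X. ?c x \<in> W} = V"
      using openin_subset[OF \<open>openin X V\<close>] \<open>V \<subseteq> U\<close> finite_part(2) by auto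
    ultimately show ?thesis
      by simp
  next
    case infinity
    then have "closedin X C" and "C \<subseteq> U"
      using compactin_imp_closedin[OF assms(1)] by (simp_all add: compactin_subtopology)
    moreover have "{x \<in> topspace X. ?c x \<in> W} = topspace X - C"
      using \<open>C \<subseteq> U\<close> infinity(2) by auto
    ultimately show ?thesis
      by (simp add: openin_diff)
  qed
qed

context inverse_semigroup_action
begin

lemma id_dom_mult:
  assumes "x \<in> id_dom \<theta> e" and "x \<in> id_dom \<theta> f"
  shows "x \<in> id_dom \<theta> (e * f)"
  using assms by (simp add: id_dom_def hom)

text \<open>
  For idempotents \<open>e \<le> f\<close> amounts to \<open>f * e = e\<close>, so \<open>\<theta>\<^bsub>f\<^esub>\<close> has to fix whatever \<open>\<theta>\<^bsub>e\<^esub>\<close> fixes.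
\<close>

lemma id_dom_mono:
  assumes "e \<in> idempotents" and "natural_le e f" and "x \<in> id_dom \<theta> e"
  shows "x \<in> id_dom \<theta> f"
proof -
  have "f * e = e"
    using assms(1,2) star_idempotent[OF assms(1)]
    by (simp add: natural_le_def idempotents_def mult.assoc)
  have "\<theta> f x = (\<theta> f \<circ>\<^sub>m \<theta> e) x"
    using assms(3) by (simp add: id_dom_def)
  also have "\<dots> = \<theta> e x"
    by (simp only: hom[symmetric] \<open>f * e = e\<close>)
  finally show ?thesis
    using assms(3) by (simp add: id_dom_def)
qed

lemma KS_point_in_tilde_set:
  assumes "x \<in> topspace X"
  shows "KS_point \<theta> x \<in> KS_tilde_set X \<theta>"
proof -
  have "KS_point \<theta> x \<in> topspace (KS_product X \<theta>)"
    using assms by (auto simp: KS_product_def KS_point_def)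
  moreover have "KS_point \<theta> x f = KS_point \<theta> x e"
    if "e \<in> idempotents" "f \<in> idempotents" "natural_le e f" "KS_point \<theta> x e \<noteq> None" for e f
    using that id_dom_mono[of e f x] by (simp add: KS_point_def split: if_splits)
  moreover have "KS_point \<theta> x (e * f) \<noteq> None"
    if "e \<in> idempotents" "f \<in> idempotents" "KS_point \<theta> x e \<noteq> None" "KS_point \<theta> x f \<noteq> None" for e f
    using that id_dom_mult[of x e f]
    by (simp add: KS_point_def idempotents_mult_closed split: if_splits)
  ultimately show ?thesis
    unfolding KS_tilde_set_def by (intro CollectI conjI ballI impI) blast+
qed

lemma KS_point_neq_infinity:
  assumes "x \<in> topspace X"
  shows "KS_point \<theta> x \<noteq> KS_infinity"
proof -
  obtain e where e: "e \<in> idempotents" "x \<in> id_dom \<theta> e"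
    using assms cover by blast
  then have "KS_point \<theta> x e \<noteq> KS_infinity e"
    by (simp add: KS_point_def KS_infinity_def)
  then show ?thesis
    by auto
qed

lemma continuous_map_KS_point:
  assumes "Hausdorff_space X"
  shows "continuous_map X (KS X \<theta>) (KS_point \<theta>)"
proof -
  have "continuous_map X (KS_product X \<theta>) (KS_point \<theta>)"
    unfolding KS_product_def continuous_map_componentwise
  proof (intro conjI ballI)
    show "KS_point \<theta> ` topspace X \<subseteq> extensional idempotents"
      by (auto simp: KS_point_def)
    fix e :: 's
    assume "e \<in> idempotents"
    then show "continuous_map X (Alexandroff_compactification (subtopology X (id_dom \<theta> e)))
        (\<lambda>x. KS_point \<theta> x e)"
      using continuous_map_collapse_complement[OF assms open_dom] by (simp add: KS_point_def)
  qed
  then show ?thesis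
    using KS_point_in_tilde_set KS_point_neq_infinity
    by (auto simp: KS_def KS_tilde_def continuous_map_in_subtopology)
qed

end

theorem proposition2p1p5:
  fixes X :: "'x topology"
    and \<theta> :: "'s::inverse_semigroup \<Rightarrow> 'x \<rightharpoonup> 'x"
  assumes "locally_compact_space X"
    and "Hausdorff_space X"
    and "inverse_semigroup_action X \<theta>"
  shows "(\<forall>x\<in>topspace X. KS_point \<theta> x \<in> topspace (KS X \<theta>)) \<and>
    continuous_map X (KS X \<theta>) (KS_point \<theta>)"
proof -
  interpret inverse_semigroup_action X \<theta>
    by (rule assms(3))
  have "continuous_map X (KS X \<theta>) (KS_point \<theta>)"
    using assms(2) by (rule continuous_map_KS_point)
  then show ?thesis
    using continuous_map_image_subset_topspace by blast
qed

end
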